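(* Let $x_1,\dots,x_n\in X$, $y_1,\dots,y_n\in Y$, weights $\beta(x_1),\dots,\beta(x_n)\ge0$, $\mathbf K=(k(x_i,x_j))_{i,j=1}^n$, $\mathcal B^{1/2}=\mathrm{diag}\big(\sqrt{\beta(x_1)},\dots,\sqrt{\beta(x_n)}\big)$, and $k_{x,n}=(k(x,x_1),\dots,k(x,x_n))^T\in\mathbb R^n$ for $x\in X$. Let $g_\lambda:[0,s]\to\mathbb R$ be a member of a regularization family. Then the regularized approximation $$\widehat f_{\mathbf z,\lambda}=g_\lambda\big(S_{X_S}^*\mathcal B S_{X_S}\big)S_{X_S}^*\mathcal B\,\mathbf y\in\mathcal G,\qquad \mathbf y=(y_1,\dots,y_n),$$ admits the representation, for all $x\in X$, $$\widehat f_{\mathbf z,\lambda}(x)=\sum_{i=1}^n\sqrt{\beta(x_i)}\,y_i\,\alpha_i(x),$$ where $\alpha(x)=(\alpha_1(x),\dots,\alpha_n(x))\in\mathbb R^n$ is given by $$\alpha(x)=\frac1n\,g_\lambda\Big(\frac1n\mathcal B^{1/2}\mathbf K\mathcal B^{1/2}\Big)\mathcal B^{1/2}k_{x,n}.$$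
   Context: $X$ is a second-countable locally compact Hausdorff space, $Y$ an infinite-dimensional real separable Hilbert space, $k:X\times X\to\mathbb R$ the reproducing kernel of a scalar RKHS $\mathcal H$, with feature map $\phi(x)=k(x,\cdot)$. $\mathcal G$ is the vector-valued RKHS of functions $X\to Y$ with operator-valued kernel $K(x,t)=k(x,t)\,Id_Y$; equivalently $\mathcal G=\{C\phi(\cdot): C\in\mathcal S_2(\mathcal H,Y)\}$ (Hilbert–Schmidt operators $\mathcal H\to Y$) with $\|C\phi(\cdot)\|_{\mathcal G}=\|C\|_{\mathcal S_2(\mathcal H,Y)}$. For $x\in X$, $K_x:Y\to\mathcal G$ is $(K_xy)(t)=k(t,x)y$. Sampling operator $S_{X_S}:\mathcal G\to Y^n$, $S_{X_S}f=(f(x_1),\dots,f(x_n))$, where $Y^n$ carries the norm $\|\mathbf y\|_n^2=\frac1n\sum_{i=1}^n\|y_i\|_Y^2$; its adjoint is $S_{X_S}^*\mathbf y=\frac1n\sum_{i=1}^nK_{x_i}y_i$. $\mathcal B=\mathrm{diag}(\beta(x_1),\dots,\beta(x_n))$ acts on $Y^n$ by $(\mathcal B\mathbf y)_i=\beta(x_i)y_i$. A regularization family is a family $g_\lambda:[0,s]\to\mathbb R$, $0<\lambda\le s$, with constants $B,D>0$ independent of $\lambda$ such that $\sup_{\sigma\in(0,s]}|\sigma g_\lambda(\sigma)|\le D$ and $\sup_{\sigma\in(0,s]}|g_\lambda(\sigma)|\le B/\lambda$. Functions of self-adjoint operators and of symmetric matrices are understood via functional calculus, and $[0,s]$ is assumed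 to contain the spectra of $S_{X_S}^*\mathcal BS_{X_S}$ and $\frac1n\mathcal B^{1/2}\mathbf K\mathcal B^{1/2}$. *)

theory Defs
  imports
    "HOL-Analysis.Analysis"
    "HOL-Computational_Algebra.Polynomial"
    "HOL-Library.Function_Algebras"
begin

text \<open>A reproducing kernel Hilbert space is a linear subspace of a function space with an inner
  product of its own, so Hilbert spaces are given here by a carrier and an inner product rather
  than by a type. The pointwise vector space structure on functions is needed for this.\<close>

instantiation "fun" :: (type, scaleR) scaleR
begin
definition scaleR_fun_def: "scaleR c f = (\<lambda>x. c *\<^sub>R f x)"
instance ..
end

instance "fun" :: (type, real_vector) real_vector
  by standard
    (simp_all add: scaleR_fun_def plus_fun_def fun_eq_iff scaleR_add_right scaleR_add_left)

subsection \<open>Hilbert spaces and their operators\<close>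

record 'v hspace =
  car :: "'v set"
  ip :: "'v \<Rightarrow> 'v \<Rightarrow> real"

definition nrm :: "'v hspace \<Rightarrow> 'v \<Rightarrow> real" where
  "nrm V u = sqrt (ip V u u)"

definition inner_product_space :: "'v::real_vector hspace \<Rightarrow> bool" where
  "inner_product_space V \<longleftrightarrow>
     subspace (car V) \<and>
     (\<forall>u\<in>car V. \<forall>v\<in>car V. ip V u v = ip V v u) \<and>
     (\<forall>u\<in>car V. \<forall>v\<in>car V. \<forall>w\<in>car V. ip V (u + v) w = ip V u w + ip V v w) \<and>
     (\<forall>c. \<forall>u\<in>car V. \<forall>v\<in>car V. ip V (c *\<^sub>R u) v = c * ip V u v) \<and>
     (\<forall>u\<in>car V. u \<noteq> 0 \<longrightarrow> 0 < ip V u u)"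

definition hilbert_space :: "'v::real_vector hspace \<Rightarrow> bool" where
  "hilbert_space V \<longleftrightarrow>
     inner_product_space V \<and>
     (\<forall>X :: nat \<Rightarrow> 'v.
        (\<forall>m. X m \<in> car V) \<and> (\<forall>e>0. \<exists>N. \<forall>m\<ge>N. \<forall>l\<ge>N. nrm V (X m - X l) < e) \<longrightarrow>
        (\<exists>u\<in>car V. (\<lambda>m. nrm V (X m - u)) \<longlonglongrightarrow> 0))"

definition bounded_op :: "'v::real_vector hspace \<Rightarrow> ('v \<Rightarrow> 'v) \<Rightarrow> bool" where
  "bounded_op V T \<longleftrightarrow>
     (\<forall>u\<in>car V. T u \<in> car V) \<and>
     (\<forall>u\<in>car V. \<forall>v\<in>car V. T (u + v) = T u + T v) \<and>
     (\<forall>c. \<forall>u\<in>car V. T (c *\<^sub>R u) = c *\<^sub>R T u) \<and>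
     (\<exists>C. \<forall>u\<in>car V. nrm V (T u) \<le> C * nrm V u)"

text \<open>Operators are determined only on the carrier; \<open>extensional\<close> pins down their junk
  values elsewhere, so that the definite descriptions below can denote.\<close>

definition adj :: "'v hspace \<Rightarrow> 'w hspace \<Rightarrow> ('v \<Rightarrow> 'w) \<Rightarrow> 'w \<Rightarrow> 'v" where
  "adj V W S = (THE A. A \<in> extensional (car W) \<and> (\<forall>w\<in>car W. A w \<in> car V) \<and>
     (\<forall>v\<in>car V. \<forall>w\<in>car W. ip W (S v) w = ip V v (A w)))"

subsection \<open>Spectrum and functional calculus\<close>

text \<open>For a self-adjoint operator the real spectrum is the whole spectrum (of the
  complexification).\<close>

definition spectrum :: "'v::real_vector hspace \<Rightarrow> ('v \<Rightarrow> 'v) \<Rightarrow> real set" where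
  "spectrum V T = {c. \<not> (\<exists>R. bounded_op V R \<and>
     (\<forall>u\<in>car V. R (T u - c *\<^sub>R u) = u \<and> T (R u) - c *\<^sub>R R u = u))}"

definition poly_op :: "real poly \<Rightarrow> ('v::real_vector \<Rightarrow> 'v) \<Rightarrow> 'v \<Rightarrow> 'v" where
  "poly_op p T u = (\<Sum>i\<le>degree p. coeff p i *\<^sub>R (T ^^ i) u)"

text \<open>The continuous functional calculus of a bounded self-adjoint operator: the value at a
  function continuous on the spectrum is the limit, in operator norm, of the values at polynomials
  that converge to the function uniformly on the spectrum. No continuity on an interval around the
  spectrum is involved; in particular, when the spectrum is finite (as for a symmetric matrix, or
  for an operator of the form (finite rank) tensor (identity)), every real function is covered.\<close>

definition is_fun_calc ::
    "'v::real_vector hspace \<Rightarrow> ('v \<Rightarrow> 'v) \<Rightarrow> (real \<Rightarrow> real) \<Rightarrow> ('v \<Rightarrow> 'v) \<Rightarrow> bool" where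
  "is_fun_calc V T f A \<longleftrightarrow>
     bounded_op V A \<and>
     (\<exists>p :: nat \<Rightarrow> real poly.
        uniform_limit (spectrum V T) (\<lambda>m. poly (p m)) f sequentially \<and>
        (\<forall>e>0. \<forall>\<^sub>F m in sequentially. \<forall>u\<in>car V.
           nrm V (poly_op (p m) T u - A u) \<le> e * nrm V u))"

definition fun_calc ::
    "'v::real_vector hspace \<Rightarrow> ('v \<Rightarrow> 'v) \<Rightarrow> (real \<Rightarrow> real) \<Rightarrow> 'v \<Rightarrow> 'v" where
  "fun_calc V T f = (THE A. A \<in> extensional (car V) \<and> is_fun_calc V T f A)"

definition euclid :: "(real^'n) hspace" where
  "euclid = \<lparr>car = UNIV, ip = (\<bullet>)\<rparr>"

definition matrix_spectrum :: "real^'n^'n \<Rightarrow> real set" where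
  "matrix_spectrum M = spectrum euclid ((*v) M)"

definition matrix_fun :: "(real \<Rightarrow> real) \<Rightarrow> real^'n^'n \<Rightarrow> real^'n^'n" where
  "matrix_fun f M = matrix (fun_calc euclid ((*v) M) f)"

definition diag_mat :: "('n \<Rightarrow> real) \<Rightarrow> real^'n^'n" where
  "diag_mat d = (\<chi> i j. if i = j then d i else 0)"

subsection \<open>Reproducing kernel Hilbert spaces\<close>

definition scalar_rkhs :: "('x \<Rightarrow> real) hspace \<Rightarrow> ('x \<Rightarrow> 'x \<Rightarrow> real) \<Rightarrow> bool" where
  "scalar_rkhs H k \<longleftrightarrow>
     hilbert_space H \<and>
     (\<forall>x. k x \<in> car H) \<and>
     (\<forall>f\<in>car H. \<forall>x. f x = ip H f (k x))"

definition K_at ::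
    "('x \<Rightarrow> 'x \<Rightarrow> 'y \<Rightarrow>\<^sub>L 'y) \<Rightarrow> 'x \<Rightarrow> 'y::real_normed_vector \<Rightarrow> 'x \<Rightarrow> 'y" where
  "K_at K x y = (\<lambda>t. blinfun_apply (K t x) y)"

definition vector_rkhs ::
    "('x \<Rightarrow> 'y::real_inner) hspace \<Rightarrow> ('x \<Rightarrow> 'x \<Rightarrow> 'y \<Rightarrow>\<^sub>L 'y) \<Rightarrow> bool" where
  "vector_rkhs G K \<longleftrightarrow>
     hilbert_space G \<and>
     (\<forall>x y. K_at K x y \<in> car G) \<and>
     (\<forall>f\<in>car G. \<forall>x y. f x \<bullet> y = ip G f (K_at K x y))"

definition scalar_type_kernel ::
    "('x \<Rightarrow> 'x \<Rightarrow> real) \<Rightarrow> 'x \<Rightarrow> 'x \<Rightarrow> 'y::real_normed_vector \<Rightarrow>\<^sub>L 'y" where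
  "scalar_type_kernel k x t = k x t *\<^sub>R id_blinfun"

subsection \<open>Sampling\<close>

text \<open>The samples are indexed by a finite type \<open>'n\<close>; \<open>n\<close> is \<open>CARD('n)\<close>.\<close>

definition sample_space :: "('y::real_inner^'n) hspace" where
  "sample_space = \<lparr>car = UNIV, ip = (\<lambda>u v. (1 / real CARD('n)) * (\<Sum>i\<in>UNIV. u $ i \<bullet> v $ i))\<rparr>"

definition sampling :: "'x^'n \<Rightarrow> ('x \<Rightarrow> 'y) \<Rightarrow> 'y^'n" where
  "sampling xs f = (\<chi> i. f (xs $ i))"

definition sampling_adj ::
    "('x \<Rightarrow> 'y::real_inner) hspace \<Rightarrow> 'x^'n \<Rightarrow> 'y^'n \<Rightarrow> 'x \<Rightarrow> 'y" where
  "sampling_adj G xs = adj G sample_space (sampling xs)"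

lemma sampling_adj_eq:
  fixes G :: "('x \<Rightarrow> 'y::real_inner) hspace" and xs :: "'x^'n"
  assumes "vector_rkhs G K"
  shows "sampling_adj G xs ys = (1 / real CARD('n)) *\<^sub>R (\<Sum>i\<in>UNIV. K_at K (xs $ i) (ys $ i))"
proof -
  let ?A = "\<lambda>ys :: 'y^'n. (1 / real CARD('n)) *\<^sub>R (\<Sum>i\<in>UNIV. K_at K (xs $ i) (ys $ i))"
  have ips: "inner_product_space G" and KG: "\<And>x y. K_at K x y \<in> car G"
    and rep: "\<And>f x y. f \<in> car G \<Longrightarrow> f x \<bullet> y = ip G f (K_at K x y)"
    using assms by (auto simp: vector_rkhs_def hilbert_space_def)
  have sub: "subspace (car G)"
    and sym: "\<And>u v. u \<in> car G \<Longrightarrow> v \<in> car G \<Longrightarrow> ip G u v = ip G v u"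
    and add: "\<And>u v w. u \<in> car G \<Longrightarrow> v \<in> car G \<Longrightarrow> w \<in> car G \<Longrightarrow> ip G (u + v) w = ip G u w + ip G v w"
    and scale: "\<And>c u v. u \<in> car G \<Longrightarrow> v \<in> car G \<Longrightarrow> ip G (c *\<^sub>R u) v = c * ip G u v"
    and pos: "\<And>u. u \<in> car G \<Longrightarrow> u \<noteq> 0 \<Longrightarrow> 0 < ip G u u"
    using ips by (auto simp: inner_product_space_def)
  have sum_car: "(\<Sum>i\<in>I. K_at K (xs $ i) (w $ i)) \<in> car G" for I :: "'n set" and w
    by (rule subspace_sum[OF sub]) (simp add: KG)
  have A_car: "?A w \<in> car G" for w
    by (intro subspace_scale[OF sub] sum_car)
  have ip_sum: "ip G (\<Sum>i\<in>I. K_at K (xs $ i) (w $ i)) f = (\<Sum>i\<in>I. f (xs $ i) \<bullet> w $ i)"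
    if f: "f \<in> car G" for I :: "'n set" and w f
  proof (induction I rule: infinite_finite_induct)
    case (insert i I)
    then show ?case
      using f add[OF KG sum_car f] sym[OF KG f] rep[OF f] by (simp del: plus_fun_apply)
  qed (use scale[OF f f, of 0] subspace_0[OF sub] f
        scale[OF subspace_0[OF sub] f, of 0] in \<open>auto simp: zero_fun_def\<close>)
  have A_adj: "ip sample_space (sampling xs f) w = ip G f (?A w)" if f: "f \<in> car G" for f w
    using sym[OF f A_car] scale[OF sum_car f] ip_sum[OF f]
    by (simp add: sample_space_def sampling_def)
  have "adj G sample_space (sampling xs) = ?A"
    unfolding adj_def
  proof (rule the_equality)
    show "?A \<in> extensional (car sample_space) \<and> (\<forall>w\<in>car sample_space. ?A w \<in> car G) \<and>
      (\<forall>v\<in>car G. \<forall>w\<in>car sample_space. ip sample_space (sampling xs v) w = ip G v (?A w))"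
      using A_car A_adj by (auto simp: sample_space_def)
  next
    fix A assume *: "A \<in> extensional (car sample_space) \<and> (\<forall>w\<in>car sample_space. A w \<in> car G) \<and>
      (\<forall>v\<in>car G. \<forall>w\<in>car sample_space. ip sample_space (sampling xs v) w = ip G v (A w))"
    show "A = ?A"
    proof
      fix w :: "'y^'n"
      have Aw: "A w \<in> car G" using * by (auto simp: sample_space_def)
      let ?d = "A w + (-1) *\<^sub>R ?A w"
      have m: "(-1) *\<^sub>R ?A w \<in> car G" by (rule subspace_scale[OF sub A_car])
      have d: "?d \<in> car G" by (rule subspace_add[OF sub Aw m])
      have "ip G ?d (A w) = ip G ?d (?A w)"
        using * A_adj[OF d] d by (auto simp: sample_space_def)
      then have "ip G ?d ?d = 0"
        using add[OF Aw m d] scale[OF A_car d, of "-1"] sym[OF d Aw] sym[OF d A_car] by simp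
      then have "?d = 0" using pos[OF d] by force
      then show "A w = ?A w" by simp
    qed
  qed
  then show ?thesis by (simp add: sampling_adj_def)
qed

definition weight_op :: "('x \<Rightarrow> real) \<Rightarrow> 'x^'n \<Rightarrow> 'y::real_vector^'n \<Rightarrow> 'y^'n" where
  "weight_op \<beta> xs ys = (\<chi> i. \<beta> (xs $ i) *\<^sub>R ys $ i)"

definition kernel_matrix :: "('x \<Rightarrow> 'x \<Rightarrow> real) \<Rightarrow> 'x^'n \<Rightarrow> real^'n^'n" where
  "kernel_matrix k xs = (\<chi> i j. k (xs $ i) (xs $ j))"

definition kernel_vector :: "('x \<Rightarrow> 'x \<Rightarrow> real) \<Rightarrow> 'x^'n \<Rightarrow> 'x \<Rightarrow> real^'n" where
  "kernel_vector k xs x = (\<chi> i. k x (xs $ i))"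

definition weight_sqrt_matrix :: "('x \<Rightarrow> real) \<Rightarrow> 'x^'n \<Rightarrow> real^'n^'n" where
  "weight_sqrt_matrix \<beta> xs = diag_mat (\<lambda>i. sqrt (\<beta> (xs $ i)))"

definition weighted_kernel_matrix ::
    "('x \<Rightarrow> 'x \<Rightarrow> real) \<Rightarrow> ('x \<Rightarrow> real) \<Rightarrow> 'x^'n \<Rightarrow> real^'n^'n" where
  "weighted_kernel_matrix k \<beta> xs =
     (1 / real CARD('n)) *\<^sub>R
       (weight_sqrt_matrix \<beta> xs ** kernel_matrix k xs ** weight_sqrt_matrix \<beta> xs)"

definition sampled_op ::
    "('x \<Rightarrow> 'y::real_inner) hspace \<Rightarrow> ('x \<Rightarrow> real) \<Rightarrow> 'x^'n \<Rightarrow> ('x \<Rightarrow> 'y) \<Rightarrow> ('x \<Rightarrow> 'y)" where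
  "sampled_op G \<beta> xs = (\<lambda>f. sampling_adj G xs (weight_op \<beta> xs (sampling xs f)))"

subsection \<open>Regularization\<close>

definition regularization_family :: "real \<Rightarrow> (real \<Rightarrow> real \<Rightarrow> real) \<Rightarrow> bool" where
  "regularization_family s g \<longleftrightarrow>
     (\<exists>B>0. \<exists>D>0. \<forall>l. 0 < l \<and> l \<le> s \<longrightarrow>
        (\<forall>\<sigma>\<in>{0<..s}. \<bar>\<sigma> * g l \<sigma>\<bar> \<le> D) \<and> (\<forall>\<sigma>\<in>{0<..s}. \<bar>g l \<sigma>\<bar> \<le> B / l))"

definition regularized_approximation ::
    "('x \<Rightarrow> 'y::real_inner) hspace \<Rightarrow> ('x \<Rightarrow> real) \<Rightarrow> 'x^'n \<Rightarrow> 'y^'n \<Rightarrow> (real \<Rightarrow> real) \<Rightarrow>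
     'x \<Rightarrow> 'y" where
  "regularized_approximation G \<beta> xs ys f =
     fun_calc G (sampled_op G \<beta> xs) f (sampling_adj G xs (weight_op \<beta> xs ys))"

definition coefficient_vector ::
    "('x \<Rightarrow> 'x \<Rightarrow> real) \<Rightarrow> ('x \<Rightarrow> real) \<Rightarrow> 'x^'n \<Rightarrow> (real \<Rightarrow> real) \<Rightarrow> 'x \<Rightarrow> real^'n" where
  "coefficient_vector k \<beta> xs f x =
     (1 / real CARD('n)) *\<^sub>R
       (matrix_fun f (weighted_kernel_matrix k \<beta> xs) *v
          (weight_sqrt_matrix \<beta> xs *v kernel_vector k xs x))"

end

theory Submission
  imports Defs
begin

text \<open>Write \<open>A = S\<^sup>* B\<^sup>1\<^sup>/\<^sup>2\<close>. Then \<open>S\<^sup>* B S = A A\<^sup>*\<close>, while \<open>A\<^sup>* A\<close> is the matrix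
  \<open>M = B\<^sup>1\<^sup>/\<^sup>2 K B\<^sup>1\<^sup>/\<^sup>2 / n\<close> acting on \<open>Y\<^sup>n\<close>, so \<open>A A\<^sup>* A = A M\<close>. Splitting \<open>Y\<^sup>n\<close> by the spectral
  projections of \<open>M\<close> shows that \<open>A A\<^sup>*\<close> is diagonalizable with eigenvalues among \<open>0\<close> and those of
  \<open>M\<close>. The functional calculus of a diagonalizable operator multiplies each eigenvector by the value
  at its eigenvalue, whence \<open>g (A A\<^sup>*) A = A g (M)\<close>, which is evaluated pointwise.\<close>

subsection \<open>The spectral theorem for symmetric matrices\<close>

text \<open>A maximizer \<open>v\<close> of \<open>u \<bullet> f u\<close> on the unit sphere of
  \<open>S\<close> exists by compactness. Stationarity at \<open>v\<close> forces the residual of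
  the eigenvalue equation to vanish.\<close>

lemma self_adjoint_eigenvector:
  fixes f :: "'a::euclidean_space \<Rightarrow> 'a"
  assumes lin: "linear f" and adj: "\<And>x y. f x \<bullet> y = x \<bullet> f y"
    and S: "subspace S" and inv: "f ` S \<subseteq> S" and nz: "S \<noteq> {0}"
  shows "\<exists>v\<in>S. norm v = 1 \<and> (\<exists>c. f v = c *\<^sub>R v)"
proof -
  let ?K = "S \<inter> sphere 0 1"
  have fsc: "f (r *\<^sub>R u) = r *\<^sub>R f u" and fadd: "f (u + w) = f u + f w" for r u w
    using lin by (auto simp: linear_iff)
  obtain x where "x \<in> S" "x \<noteq> 0" using nz subspace_0[OF S] by blast
  then have "(1 / norm x) *\<^sub>R x \<in> ?K" using subspace_scale[OF S] by auto
  then have ne: "?K \<noteq> {}" by blast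
  have comp: "compact ?K" by (simp add: S closed_Int_compact closed_subspace)
  have "continuous_on ?K (\<lambda>u. u \<bullet> f u)"
    by (intro continuous_intros linear_continuous_on) (use lin linear_conv_bounded_linear in blast)
  from continuous_attains_sup[OF comp ne this]
  obtain v where v: "v \<in> ?K" and max: "\<And>u. u \<in> ?K \<Longrightarrow> u \<bullet> f u \<le> v \<bullet> f v" by blast
  define c where "c = v \<bullet> f v"
  have vv: "v \<bullet> v = 1" using v by (simp add: norm_eq_1)
  \<comment> \<open>Both sides are homogeneous of degree 2, so the maximum on the sphere bounds the
    quadratic form on all of \<open>S\<close>.\<close>
  have le: "u \<bullet> f u \<le> c * (u \<bullet> u)" if u: "u \<in> S" for u
  proof (cases "u = 0")
    case False
    have "(1 / norm u) *\<^sub>R u \<in> ?K" using False u subspace_scale[OF S] by auto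
    from max[OF this] show ?thesis using False
      by (simp add: fsc c_def[symmetric] field_simps dot_square_norm power2_eq_square)
  qed (use lin in \<open>simp add: linear_0\<close>)
  \<comment> \<open>The residual of the eigenvalue equation. It is orthogonal to \<open>v\<close>
    because \<open>c\<close> is the Rayleigh quotient of the unit vector \<open>v\<close>.\<close>
  define w where "w = c *\<^sub>R v - f v"
  have wS: "w \<in> S" unfolding w_def using v inv S
    by (auto intro!: subspace_diff subspace_scale)
  have wv: "w \<bullet> v = 0" using vv by (simp add: w_def c_def algebra_simps inner_commute)
  have wf: "w \<bullet> f v = - (w \<bullet> w)"
  proof -
    have "w \<bullet> w = w \<bullet> (c *\<^sub>R v - f v)" by (simp add: w_def)
    then show ?thesis using wv by (simp add: inner_diff_right)
  qed
  have vw: "v \<bullet> w = 0" and vfw: "v \<bullet> f w = - (w \<bullet> w)"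
    using wv wf adj[of v w] by (simp_all add: inner_commute)
  \<comment> \<open>first variation of the Rayleigh quotient at its maximum \<open>v\<close>, in the direction \<open>w\<close>\<close>
  have key: "2 * t * (- (w \<bullet> w)) + t^2 * (w \<bullet> f w) \<le> t^2 * c * (w \<bullet> w)" for t
  proof -
    have "v + t *\<^sub>R w \<in> S" using v wS S by (auto intro!: subspace_add subspace_scale)
    from le[OF this] show ?thesis
      by (simp add: fadd fsc inner_add_left inner_add_right c_def[symmetric] wv vw wf vfw vv
          power2_eq_square algebra_simps)
  qed
  have "w \<bullet> w = 0"
  proof (rule ccontr)
    assume "w \<bullet> w \<noteq> 0"
    then have p: "w \<bullet> w > 0" by simp
    define a where "a = c * (w \<bullet> w) - w \<bullet> f w"
    have k: "- 2 * t * (w \<bullet> w) \<le> t^2 * a" for t using key[of t] by (simp add: a_def algebra_simps)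
    \<comment> \<open>At \<open>t = - e\<close> the linear term contributes
      \<open>2 * e * (w \<bullet> w)\<close>, while \<open>e\<close> is small enough that the
      quadratic term is at most \<open>e * (w \<bullet> w)\<close>. The summand 1 keeps the
      denominator positive.\<close>
    define e where "e = (w \<bullet> w) / (\<bar>a\<bar> + 1)"
    have e0: "e > 0" using p by (simp add: e_def)
    have "e * a \<le> e * (\<bar>a\<bar> + 1)" using e0 by (intro mult_left_mono) auto
    also have "\<dots> = w \<bullet> w" by (simp add: e_def)
    finally have "e * a \<le> w \<bullet> w" .
    moreover have "2 * (w \<bullet> w) * e \<le> (e * a) * e"
      using k[of "- e"] by (simp add: power2_eq_square algebra_simps)
    then have "2 * (w \<bullet> w) \<le> e * a" using e0 by (simp add: mult_le_cancel_right)
    ultimately show False using p by linarith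
  qed
  then have "f v = c *\<^sub>R v" by (simp add: w_def)
  then show ?thesis using v by auto
qed

text \<open>Induction on the dimension: split off a unit eigenvector and pass to its orthogonal
  complement inside \<open>S\<close>. The expansion identity stands in for orthonormality, since it
  is the form in which the basis yields a resolution of the identity.\<close>

lemma self_adjoint_eigenbasis:
  fixes f :: "'a::euclidean_space \<Rightarrow> 'a"
  assumes lin: "linear f" and adj: "\<And>x y. f x \<bullet> y = x \<bullet> f y"
    and "subspace S" and "f ` S \<subseteq> S"
  shows "\<exists>B. finite B \<and> B \<subseteq> S \<and> (\<forall>b\<in>B. \<exists>c. f b = c *\<^sub>R b) \<and> (\<forall>x\<in>S. (\<Sum>b\<in>B. (b \<bullet> x) *\<^sub>R b) = x)"
  using assms(3,4)
proof (induction "dim S" arbitrary: S rule: less_induct)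
  case less
  show ?case
  proof (cases "S = {0}")
    case True
    then show ?thesis by (intro exI[of _ "{}"]) auto
  next
    case False
    obtain v c where v: "v \<in> S" "norm v = 1" and fv: "f v = c *\<^sub>R v"
      using self_adjoint_eigenvector[OF lin adj less.prems False] by blast
    have vv: "v \<bullet> v = 1" using v by (simp add: norm_eq_1)
    define S' where "S' = {x \<in> S. v \<bullet> x = 0}"
    have S': "subspace S'" using less.prems(1)
      by (auto simp: S'_def subspace_def inner_add_right)
    \<comment> \<open>Self-adjointness: \<open>v \<bullet> f x = f v \<bullet> x\<close>, a multiple
      of \<open>v \<bullet> x\<close>, which is 0.\<close>
    have inv: "f ` S' \<subseteq> S'"
      using less.prems(2) fv by (auto simp: S'_def adj[of v, symmetric])
    have "v \<notin> S'" "S' \<subseteq> S" using vv by (auto simp: S'_def)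
    then have "S' \<subset> S" using v by blast
    then have "dim S' < dim S"
      using S' less.prems(1) by (metis dim_psubset span_eq_iff)
    from less.hyps[OF this S' inv] obtain B where B: "finite B" "B \<subseteq> S'"
      "\<forall>b\<in>B. \<exists>c. f b = c *\<^sub>R b" and rep: "\<forall>x\<in>S'. (\<Sum>b\<in>B. (b \<bullet> x) *\<^sub>R b) = x" by blast
    have vB: "v \<notin> B" using B(2) vv by (auto simp: S'_def)
    have "(\<Sum>b\<in>insert v B. (b \<bullet> x) *\<^sub>R b) = x" if x: "x \<in> S" for x
    proof -
      \<comment> \<open>Subtracting the component along \<open>v\<close> lands in \<open>S'\<close>
        and leaves the coefficients against \<open>B\<close> unchanged, as \<open>B\<close> is
        orthogonal to \<open>v\<close>.\<close>
      let ?y = "x - (v \<bullet> x) *\<^sub>R v"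
      have "?y \<in> S'" using x v vv less.prems(1)
        by (auto simp: S'_def inner_diff_right intro!: subspace_diff subspace_scale)
      then have "(\<Sum>b\<in>B. (b \<bullet> ?y) *\<^sub>R b) = ?y" using rep by blast
      moreover have "b \<bullet> ?y = b \<bullet> x" if "b \<in> B" for b
        using B(2) that by (auto simp: S'_def inner_diff_right inner_commute)
      ultimately have "(\<Sum>b\<in>B. (b \<bullet> x) *\<^sub>R b) = ?y" by simp
      then show ?thesis using B(1) vB by simp
    qed
    then show ?thesis using B v fv by (intro exI[of _ "insert v B"]) (auto simp: S'_def)
  qed
qed

text \<open>\<open>P c\<close> is the sum of the rank-one matrices of the basis eigenvectors with
  eigenvalue \<open>c\<close>. For \<open>c\<close> outside \<open>F\<close> it is an empty sum, so
  the eigenvalue equation holds for every real \<open>c\<close>.\<close>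

lemma symmetric_matrix_spectral:
  fixes M :: "real^'n^'n"
  assumes sym: "transpose M = M"
  obtains F P where "finite F" and "\<And>c i j. P c $ i $ j = P c $ j $ i"
    and "\<And>c. M ** P c = c *\<^sub>R P c" and "(\<Sum>c\<in>F. P c) = mat 1"
proof -
  have "(M *v x) \<bullet> y = x \<bullet> (M *v y)" for x y
    using sym by (metis dot_lmul_matrix vector_transpose_matrix)
  from self_adjoint_eigenbasis[OF matrix_vector_mul_linear this subspace_UNIV]
  obtain B where B: "finite B" "\<forall>b\<in>B. \<exists>c. M *v b = c *\<^sub>R b"
    and rep: "\<And>x. (\<Sum>b\<in>B. (b \<bullet> x) *\<^sub>R b) = x" by auto
  from B(2) obtain \<mu> where mu: "\<And>b. b \<in> B \<Longrightarrow> M *v b = \<mu> b *\<^sub>R b" by metis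
  define Q :: "real^'n \<Rightarrow> real^'n^'n" where "Q b = (\<chi> i j. b $ i * b $ j)" for b
  define P where "P c = (\<Sum>b | b \<in> B \<and> \<mu> b = c. Q b)" for c
  show thesis
  proof (rule that[of "\<mu> ` B" P])
    show "P c $ i $ j = P c $ j $ i" for c i j
      by (simp add: P_def Q_def mult.commute)
    have MQ: "M ** Q b = \<mu> b *\<^sub>R Q b" if "b \<in> B" for b
    proof -
      have "(\<Sum>l\<in>UNIV. M $ i $ l * b $ l) = \<mu> b * b $ i" for i
        using arg_cong[OF mu[OF that], of "\<lambda>x. x $ i"] by (simp add: matrix_vector_mult_def)
      then show ?thesis
        by (simp add: vec_eq_iff Q_def matrix_matrix_mult_def mult.assoc[symmetric]
            sum_distrib_right[symmetric])
    qed
    have "M ** P c = (\<Sum>b | b \<in> B \<and> \<mu> b = c. M ** Q b)" for c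
      by (simp add: P_def vec_eq_iff matrix_matrix_mult_def sum_distrib_left)
        (auto intro: sum.swap)
    then show "M ** P c = c *\<^sub>R P c" for c
      by (simp add: MQ P_def scaleR_sum_right)
    have "(\<Sum>c\<in>\<mu> ` B. P c) = (\<Sum>b\<in>B. Q b)"
      unfolding P_def using B(1) sum.group[of B "\<mu> ` B" \<mu> Q] by simp
    also have "\<dots> = mat 1"
    proof -
      \<comment> \<open>Component \<open>i\<close> of the expansion of the \<open>j\<close>-th unit
        vector.\<close>
      have "(\<Sum>b\<in>B. b $ i * b $ j) = (if i = j then 1 else 0)" for i j
        using arg_cong[OF rep[of "axis j 1"], of "\<lambda>x. x $ i"]
        by (simp add: inner_axis mult.commute) (simp add: axis_def)
      then show ?thesis by (simp add: vec_eq_iff Q_def mat_def)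
    qed
    finally show "(\<Sum>c\<in>\<mu> ` B. P c) = mat 1" .
  qed (use B in simp)
qed

subsection \<open>Functional calculus of diagonalizable operators\<close>

text \<open>Newton's scheme: the polynomial \<open>q\<close> vanishes on the old nodes but not at
  the new one, so a multiple of it corrects the value there.\<close>

lemma poly_interpolation:
  fixes f :: "'a::field \<Rightarrow> 'a"
  assumes "finite F"
  shows "\<exists>p. \<forall>c\<in>F. poly p c = f c"
  using assms
proof (induction F)
  case (insert a F)
  then obtain p where p: "\<forall>c\<in>F. poly p c = f c" by blast
  define q where "q = (\<Prod>c\<in>F. [:- c, 1:])"
  have "poly q a \<noteq> 0" using insert by (auto simp: q_def poly_prod)
  moreover have "poly q c = 0" if "c \<in> F" for c
    using that insert by (auto simp: q_def poly_prod)
  ultimately show ?case using p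
    by (intro exI[of _ "p + smult ((f a - poly p a) / poly q a) q"]) auto
qed simp

section \<open>Inner product spaces given by a carrier\<close>

locale ip_space =
  fixes V :: "'v::real_vector hspace"
  assumes ips: "inner_product_space V"
begin

lemma sub: "subspace (car V)" using ips by (simp add: inner_product_space_def)

lemma mem [simp, intro]:
  "0 \<in> car V"
  "u \<in> car V \<Longrightarrow> v \<in> car V \<Longrightarrow> u + v \<in> car V"
  "u \<in> car V \<Longrightarrow> v \<in> car V \<Longrightarrow> u - v \<in> car V"
  "u \<in> car V \<Longrightarrow> c *\<^sub>R u \<in> car V"
  using sub by (auto intro: subspace_0 subspace_add subspace_diff subspace_scale)

lemma mem_sum [intro]: "(\<And>i. i \<in> I \<Longrightarrow> w i \<in> car V) \<Longrightarrow> (\<Sum>i\<in>I. w i) \<in> car V"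
  using sub by (rule subspace_sum)

lemma ip_sym: "u \<in> car V \<Longrightarrow> v \<in> car V \<Longrightarrow> ip V u v = ip V v u"
  and ip_add: "u \<in> car V \<Longrightarrow> v \<in> car V \<Longrightarrow> w \<in> car V \<Longrightarrow> ip V (u + v) w = ip V u w + ip V v w"
  and ip_scale: "u \<in> car V \<Longrightarrow> v \<in> car V \<Longrightarrow> ip V (c *\<^sub>R u) v = c * ip V u v"
  and ip_pos: "u \<in> car V \<Longrightarrow> u \<noteq> 0 \<Longrightarrow> 0 < ip V u u"
  using ips by (auto simp: inner_product_space_def)

lemma ip_add_right:
  "u \<in> car V \<Longrightarrow> v \<in> car V \<Longrightarrow> w \<in> car V \<Longrightarrow> ip V w (u + v) = ip V w u + ip V w v"
  using ip_add ip_sym by (metis mem(2))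

lemma ip_scale_right: "u \<in> car V \<Longrightarrow> v \<in> car V \<Longrightarrow> ip V u (c *\<^sub>R v) = c * ip V u v"
  using ip_scale ip_sym by (metis mem(4))

lemma ip_zero [simp]: "u \<in> car V \<Longrightarrow> ip V 0 u = 0"
  using ip_scale[of u u 0] by simp

lemma ip_nonneg: "u \<in> car V \<Longrightarrow> 0 \<le> ip V u u"
  using ip_pos ip_zero by (cases "u = 0") (auto intro: less_imp_le)

lemma nrm_nonneg: "u \<in> car V \<Longrightarrow> 0 \<le> nrm V u"
  by (simp add: nrm_def ip_nonneg)

lemma nrm_power2: "u \<in> car V \<Longrightarrow> (nrm V u)\<^sup>2 = ip V u u"
  by (simp add: nrm_def ip_nonneg)

lemma nrm_scale: "u \<in> car V \<Longrightarrow> nrm V (c *\<^sub>R u) = \<bar>c\<bar> * nrm V u"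
  by (simp add: nrm_def ip_scale ip_scale_right real_sqrt_mult mult.assoc[symmetric])

lemma nrm_eq_0: "u \<in> car V \<Longrightarrow> nrm V u \<le> 0 \<Longrightarrow> u = 0"
  using ip_pos by (force simp: nrm_def)

text \<open>With \<open>a\<close> and \<open>b\<close> the norms of \<open>u\<close> and
  \<open>v\<close>, the vector \<open>b *\<^sub>R u - a *\<^sub>R v\<close> has squared norm
  \<open>2 * (a * b) * (a * b - ip V u v)\<close>, which is nonnegative.\<close>

lemma Cauchy_Schwarz:
  assumes u: "u \<in> car V" and v: "v \<in> car V"
  shows "ip V u v \<le> nrm V u * nrm V v"
proof -
  define a b where "a = nrm V u" and "b = nrm V v"
  have ab: "0 \<le> a" "0 \<le> b" "ip V u u = a\<^sup>2" "ip V v v = b\<^sup>2"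
    using u v by (auto simp: a_def b_def nrm_nonneg nrm_power2)
  show ?thesis
  proof (cases "a = 0 \<or> b = 0")
    case True
    then have "u = 0 \<or> v = 0" using u v nrm_eq_0 by (auto simp: a_def b_def)
    then have "ip V u v = 0" using u v ip_sym by (metis ip_zero)
    then show ?thesis using ab by (simp flip: a_def b_def)
  next
    case False
    then have pos: "0 < a * b" using ab by simp
    have m: "b *\<^sub>R u \<in> car V" "(- a) *\<^sub>R v \<in> car V" using u v by blast+
    have "0 \<le> ip V (b *\<^sub>R u + (- a) *\<^sub>R v) (b *\<^sub>R u + (- a) *\<^sub>R v)"
      using m by (blast intro: ip_nonneg)
    also have "\<dots> = 2 * (a * b) * (a * b - ip V u v)"
      unfolding ip_add[OF m mem(2)[OF m]] ip_add_right[OF m m(1)] ip_add_right[OF m m(2)]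
      using u v m ab(3,4) ip_sym[OF v u]
      by (simp only: ip_scale ip_scale_right mem) (simp add: power2_eq_square algebra_simps)
    finally show ?thesis using pos by (simp add: zero_le_mult_iff flip: a_def b_def)
  qed
qed

lemma nrm_triangle:
  assumes u: "u \<in> car V" and v: "v \<in> car V"
  shows "nrm V (u + v) \<le> nrm V u + nrm V v"
proof (rule power2_le_imp_le)
  have "(nrm V (u + v))\<^sup>2 = ip V u u + 2 * ip V u v + ip V v v"
    using u v by (simp add: nrm_power2 ip_add ip_add_right ip_sym[OF v u])
  then show "(nrm V (u + v))\<^sup>2 \<le> (nrm V u + nrm V v)\<^sup>2"
    using Cauchy_Schwarz[OF u v] u v by (simp add: power2_sum nrm_power2)
qed (use u v in \<open>simp add: nrm_nonneg\<close>)

section \<open>Bounded operators and their algebra\<close>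

lemma bounded_opI:
  assumes "\<And>u. u \<in> car V \<Longrightarrow> T u \<in> car V"
    and "\<And>u v. u \<in> car V \<Longrightarrow> v \<in> car V \<Longrightarrow> T (u + v) = T u + T v"
    and "\<And>c u. u \<in> car V \<Longrightarrow> T (c *\<^sub>R u) = c *\<^sub>R T u"
    and "\<And>u. u \<in> car V \<Longrightarrow> nrm V (T u) \<le> C * nrm V u"
  shows "bounded_op V T"
  unfolding bounded_op_def using assms by (intro conjI allI ballI exI[of _ C])

lemma bounded_op_car: "bounded_op V T \<Longrightarrow> u \<in> car V \<Longrightarrow> T u \<in> car V"
  and bounded_op_plus:
    "bounded_op V T \<Longrightarrow> u \<in> car V \<Longrightarrow> v \<in> car V \<Longrightarrow> T (u + v) = T u + T v"
  and bounded_op_scaleR: "bounded_op V T \<Longrightarrow> u \<in> car V \<Longrightarrow> T (c *\<^sub>R u) = c *\<^sub>R T u"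
  by (simp_all add: bounded_op_def)

lemma bounded_op_0: "bounded_op V T \<Longrightarrow> T 0 = 0"
  using bounded_op_scaleR[of T 0 0] by simp

lemma bounded_op_sum:
  assumes T: "bounded_op V T" and "finite I" and "\<And>i. i \<in> I \<Longrightarrow> w i \<in> car V"
  shows "T (\<Sum>i\<in>I. w i) = (\<Sum>i\<in>I. T (w i))"
  using assms(2,3)
  by (induction I) (auto simp: bounded_op_0[OF T] bounded_op_plus[OF T] mem_sum)

lemma bounded_op_bound:
  assumes "bounded_op V T"
  obtains C where "0 \<le> C" "\<forall>u\<in>car V. nrm V (T u) \<le> C * nrm V u"
proof -
  have "\<exists>C. \<forall>u\<in>car V. nrm V (T u) \<le> C * nrm V u"
    using assms by (simp add: bounded_op_def)
  then obtain C where C: "\<And>u. u \<in> car V \<Longrightarrow> nrm V (T u) \<le> C * nrm V u" by blast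
  \<comment> \<open>On a trivial carrier the given constant may be negative, hence the absolute
    value.\<close>
  have "C * nrm V u \<le> \<bar>C\<bar> * nrm V u" if "u \<in> car V" for u
    using nrm_nonneg[OF that] by (intro mult_right_mono) auto
  with C have "nrm V (T u) \<le> \<bar>C\<bar> * nrm V u" if "u \<in> car V" for u
    using that order_trans by blast
  then show thesis by (intro that[of "\<bar>C\<bar>"]) auto
qed

lemma bounded_op_id: "bounded_op V (\<lambda>u. u)"
  by (rule bounded_opI[where C = 1]) auto

lemma bounded_op_zero: "bounded_op V (\<lambda>u. 0)"
  by (rule bounded_opI[where C = 0]) (auto simp: nrm_def)

lemma bounded_op_add:
  assumes S: "bounded_op V S" and T: "bounded_op V T"
  shows "bounded_op V (\<lambda>u. S u + T u)"
proof -
  obtain C where C: "\<forall>u\<in>car V. nrm V (S u) \<le> C * nrm V u"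
    using bounded_op_bound[OF S] by blast
  obtain D where D: "\<forall>u\<in>car V. nrm V (T u) \<le> D * nrm V u"
    using bounded_op_bound[OF T] by blast
  show ?thesis
  proof (rule bounded_opI[where C = "C + D"])
    fix u assume u: "u \<in> car V"
    show "nrm V (S u + T u) \<le> (C + D) * nrm V u"
      using nrm_triangle[of "S u" "T u"] C[rule_format, OF u] D[rule_format, OF u] u S T
      by (auto simp: bounded_op_car algebra_simps)
  qed (use S T in \<open>auto simp: bounded_op_car bounded_op_plus bounded_op_scaleR scaleR_add_right\<close>)
qed

lemma bounded_op_scale:
  assumes S: "bounded_op V S"
  shows "bounded_op V (\<lambda>u. a *\<^sub>R S u)"
proof -
  obtain C where C: "\<forall>u\<in>car V. nrm V (S u) \<le> C * nrm V u"
    using bounded_op_bound[OF S] by blast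
  show ?thesis
  proof (rule bounded_opI[where C = "\<bar>a\<bar> * C"])
    fix u assume u: "u \<in> car V"
    show "nrm V (a *\<^sub>R S u) \<le> \<bar>a\<bar> * C * nrm V u"
      using C[rule_format, OF u] u S by (simp add: nrm_scale bounded_op_car mult.assoc mult_left_mono)
  qed (use S in \<open>auto simp: bounded_op_car bounded_op_plus bounded_op_scaleR scaleR_add_right\<close>)
qed

lemma bounded_op_compose:
  assumes S: "bounded_op V S" and T: "bounded_op V T"
  shows "bounded_op V (\<lambda>u. S (T u))"
proof -
  obtain C where C0: "0 \<le> C" and C: "\<forall>u\<in>car V. nrm V (S u) \<le> C * nrm V u"
    using bounded_op_bound[OF S] by blast
  obtain D where D: "\<forall>u\<in>car V. nrm V (T u) \<le> D * nrm V u"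
    using bounded_op_bound[OF T] by blast
  show ?thesis
  proof (rule bounded_opI[where C = "C * D"])
    fix u assume u: "u \<in> car V"
    have "nrm V (S (T u)) \<le> C * nrm V (T u)" using C u T by (simp add: bounded_op_car)
    also have "\<dots> \<le> C * (D * nrm V u)" using C0 D[rule_format, OF u] by (simp add: mult_left_mono)
    finally show "nrm V (S (T u)) \<le> C * D * nrm V u" by (simp add: mult.assoc)
  qed (use S T in \<open>auto simp: bounded_op_car bounded_op_plus bounded_op_scaleR\<close>)
qed

lemma bounded_op_Sum:
  assumes "finite I" and "\<And>i. i \<in> I \<Longrightarrow> bounded_op V (S i)"
  shows "bounded_op V (\<lambda>u. \<Sum>i\<in>I. S i u)"
  using assms by (induction I) (auto simp: bounded_op_zero bounded_op_add)

lemma bounded_op_funpow: "bounded_op V T \<Longrightarrow> bounded_op V (T ^^ i)"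
  by (induction i) (auto simp: bounded_op_id bounded_op_compose id_def comp_def)

lemma bounded_op_poly_op: "bounded_op V T \<Longrightarrow> bounded_op V (poly_op p T)"
  unfolding poly_op_def[abs_def]
  by (intro bounded_op_Sum bounded_op_scale bounded_op_funpow) auto

section \<open>Eigenvectors, spectrum and functional calculus\<close>

lemma poly_op_eigenvector:
  assumes T: "bounded_op V T" and w: "w \<in> car V" "T w = c *\<^sub>R w"
  shows "poly_op p T w = poly p c *\<^sub>R w"
proof -
  have "(T ^^ i) w = c ^ i *\<^sub>R w" for i
    by (induction i) (use w in \<open>auto simp: bounded_op_scaleR[OF T]\<close>)
  then show ?thesis by (simp add: poly_op_def poly_altdef scaleR_sum_left)
qed

lemma eigenvalue_in_spectrum:
  assumes w: "w \<in> car V" "T w = c *\<^sub>R w" "w \<noteq> 0"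
  shows "c \<in> spectrum V T"
proof (rule ccontr)
  assume "c \<notin> spectrum V T"
  then obtain R where R: "bounded_op V R" "R (T w - c *\<^sub>R w) = w"
    using w(1) by (auto simp: spectrum_def)
  then show False using w bounded_op_0[OF R(1)] by simp
qed

text \<open>Components may be 0, so \<open>F\<close> may contain numbers that are not eigenvalues.
  This allows adjoining 0 to a set of eigenvalues without deciding whether it is one.\<close>

definition diagonalizable :: "('v \<Rightarrow> 'v) \<Rightarrow> real set \<Rightarrow> bool" where
  "diagonalizable T F \<longleftrightarrow> bounded_op V T \<and> finite F \<and>
     (\<forall>u\<in>car V. \<exists>w. (\<forall>c\<in>F. w c \<in> car V \<and> T (w c) = c *\<^sub>R w c) \<and> u = (\<Sum>c\<in>F. w c))"

text \<open>For \<open>c\<close> outside \<open>F\<close> the resolvent is a polynomial in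
  \<open>T\<close>: interpolate \<open>1 / (d - c)\<close> at the points \<open>d\<close> of
  \<open>F\<close>. Being a polynomial in \<open>T\<close>, it is bounded.\<close>

lemma spectrum_diagonalizable:
  assumes d: "diagonalizable T F"
  shows "spectrum V T \<subseteq> F"
proof
  fix c assume "c \<in> spectrum V T"
  show "c \<in> F"
  proof (rule ccontr)
    assume cF: "c \<notin> F"
    have T: "bounded_op V T" and F: "finite F" using d by (auto simp: diagonalizable_def)
    obtain p where p: "\<forall>d\<in>F. poly p d = 1 / (d - c)"
      using poly_interpolation[OF F, of "\<lambda>d. 1 / (d - c)"] by blast
    let ?R = "poly_op p T"
    have R: "bounded_op V ?R" by (rule bounded_op_poly_op[OF T])
    have "?R (T u - c *\<^sub>R u) = u \<and> T (?R u) - c *\<^sub>R ?R u = u" if u: "u \<in> car V" for u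
    proof -
      obtain w where w: "\<And>d. d \<in> F \<Longrightarrow> w d \<in> car V" "\<And>d. d \<in> F \<Longrightarrow> T (w d) = d *\<^sub>R w d"
        and uw: "u = (\<Sum>d\<in>F. w d)"
        using d u by (fastforce simp: diagonalizable_def)
      have Rw: "?R (w d) = (1 / (d - c)) *\<^sub>R w d" if "d \<in> F" for d
        using poly_op_eigenvector[OF T w(1)[OF that] w(2)[OF that]] p that by simp
      have nz: "d - c \<noteq> 0" if "d \<in> F" for d using that cF by auto
      have "T u - c *\<^sub>R u = (\<Sum>d\<in>F. (d - c) *\<^sub>R w d)"
        unfolding uw using w F
        by (simp add: bounded_op_sum[OF T] scaleR_sum_right scaleR_diff_left sum_subtractf)
      then have "?R (T u - c *\<^sub>R u) = (\<Sum>d\<in>F. (d - c) *\<^sub>R ?R (w d))"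
        using w F by (simp add: bounded_op_sum[OF R] bounded_op_scaleR[OF R])
      also have "\<dots> = u" unfolding uw using Rw nz by (intro sum.cong) auto
      finally have 1: "?R (T u - c *\<^sub>R u) = u" .
      have Ru: "?R u = (\<Sum>d\<in>F. (1 / (d - c)) *\<^sub>R w d)"
        unfolding uw using w F Rw by (simp add: bounded_op_sum[OF R])
      have "T (?R u) - c *\<^sub>R ?R u = (\<Sum>d\<in>F. (d / (d - c) - c / (d - c)) *\<^sub>R w d)"
        unfolding Ru using w F
        by (simp add: bounded_op_sum[OF T] bounded_op_scaleR[OF T] scaleR_sum_right
            scaleR_diff_left sum_subtractf)
      also have "\<dots> = u" unfolding uw using nz
        by (intro sum.cong) (auto simp: diff_divide_distrib[symmetric])
      finally show ?thesis using 1 by blast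
    qed
    then show False using R \<open>c \<in> spectrum V T\<close> by (auto simp: spectrum_def)
  qed
qed

text \<open>The approximating polynomials act on \<open>w\<close> as the scalars
  \<open>poly (p m) c\<close>. If \<open>w\<close> is nonzero, \<open>c\<close> lies in the
  spectrum, so these scalars tend to \<open>f c\<close>, while the operators tend to
  \<open>A\<close>.\<close>

lemma is_fun_calc_eigenvector:
  assumes T: "bounded_op V T" and A: "is_fun_calc V T f A" and w: "w \<in> car V" "T w = c *\<^sub>R w"
  shows "A w = f c *\<^sub>R w"
proof (cases "w = 0")
  case True
  then show ?thesis using A bounded_op_0 by (auto simp: is_fun_calc_def)
next
  case False
  have Aw: "A w \<in> car V" using A w by (auto simp: is_fun_calc_def bounded_op_car)
  obtain p where u: "uniform_limit (spectrum V T) (\<lambda>m. poly (p m)) f sequentially"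
    and e: "\<And>e. e > 0 \<Longrightarrow> \<forall>\<^sub>F m in sequentially. \<forall>u\<in>car V.
           nrm V (poly_op (p m) T u - A u) \<le> e * nrm V u"
    using A by (auto simp: is_fun_calc_def)
  have lim: "(\<lambda>m. poly (p m) c) \<longlonglongrightarrow> f c"
    using tendsto_uniform_limitI[OF u] eigenvalue_in_spectrum[of w T c] w False by blast
  \<comment> \<open>The shape \<open>0 + e\<close> is the one expected by
    \<open>field_le_epsilon\<close>.\<close>
  have "nrm V (f c *\<^sub>R w - A w) \<le> 0 + e" if e0: "e > 0" for e
  proof -
    \<comment> \<open>Two errors of at most \<open>d * nrm V w\<close> must add up to at most
      \<open>e\<close>; the summand 1 covers a small norm of \<open>w\<close>.\<close>
    define d where "d = e / (2 * (nrm V w + 1))"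
    have n: "0 \<le> nrm V w" using w by (simp add: nrm_nonneg)
    have d: "d > 0" "2 * d * nrm V w \<le> e" using e0 n by (auto simp: d_def field_simps)
    have "\<forall>\<^sub>F m in sequentially. \<bar>poly (p m) c - f c\<bar> < d"
      using tendstoD[OF lim d(1)] by (simp add: dist_real_def)
    with e[OF d(1)] have "\<forall>\<^sub>F m in sequentially. nrm V (f c *\<^sub>R w - A w) \<le> e"
    proof eventually_elim
      case (elim m)
      have "f c *\<^sub>R w - A w = (f c - poly (p m) c) *\<^sub>R w + (poly (p m) c *\<^sub>R w - A w)"
        by (simp add: algebra_simps)
      also have "nrm V \<dots> \<le> nrm V ((f c - poly (p m) c) *\<^sub>R w) + nrm V (poly (p m) c *\<^sub>R w - A w)"
        using w Aw by (intro nrm_triangle) auto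
      also have "\<dots> \<le> d * nrm V w + d * nrm V w"
      proof (rule add_mono)
        show "nrm V ((f c - poly (p m) c) *\<^sub>R w) \<le> d * nrm V w"
          using elim n w by (simp add: nrm_scale mult_right_mono)
        show "nrm V (poly (p m) c *\<^sub>R w - A w) \<le> d * nrm V w"
          using elim w(1) poly_op_eigenvector[OF T w, of "p m"] by auto
      qed
      finally show ?case using d by simp
    qed
    then show ?thesis by simp
  qed
  then have "nrm V (f c *\<^sub>R w - A w) \<le> 0" by (rule field_le_epsilon)
  then show ?thesis using nrm_eq_0 w Aw by (metis eq_iff_diff_eq_0 mem(3,4))
qed

text \<open>This makes the definite description denote. Existence: the spectrum lies in the finite
  set \<open>F\<close>, so a constant sequence of one interpolating polynomial serves. Uniqueness:
  the values on eigenvectors are forced, and these span the carrier.\<close>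

lemma fun_calc_diagonalizable:
  assumes d: "diagonalizable T F"
  shows "is_fun_calc V T f (fun_calc V T f)"
proof -
  have T: "bounded_op V T" and F: "finite F" using d by (auto simp: diagonalizable_def)
  obtain p where p: "\<forall>c\<in>F. poly p c = f c" using poly_interpolation[OF F] by blast
  \<comment> \<open>Restricting fixes the values off the carrier, as \<open>extensional\<close>
    demands.\<close>
  let ?A = "restrict (poly_op p T) (car V)"
  have "bounded_op V ?A" using bounded_op_poly_op[OF T, of p] by (auto simp: bounded_op_def)
  moreover have "uniform_limit (spectrum V T) (\<lambda>m. poly p) f sequentially"
    using p spectrum_diagonalizable[OF d] by (auto intro!: uniform_limitI always_eventually)
  moreover have "nrm V (poly_op p T u - ?A u) \<le> e * nrm V u" if "e > 0" "u \<in> car V" for e u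
    using that nrm_nonneg[of u] by (simp add: nrm_def)
  ultimately have ex: "?A \<in> extensional (car V) \<and> is_fun_calc V T f ?A"
    unfolding is_fun_calc_def by (auto intro!: exI[of _ "\<lambda>_. p"])
  have uniq: "A = B" if A: "A \<in> extensional (car V)" "is_fun_calc V T f A"
    and B: "B \<in> extensional (car V)" "is_fun_calc V T f B" for A B
  proof (rule extensionalityI[OF A(1) B(1)])
    fix u assume "u \<in> car V"
    then obtain w where w: "\<And>d. d \<in> F \<Longrightarrow> w d \<in> car V" "\<And>d. d \<in> F \<Longrightarrow> T (w d) = d *\<^sub>R w d"
      and uw: "u = (\<Sum>d\<in>F. w d)"
      using d by (fastforce simp: diagonalizable_def)
    have "A (w d) = B (w d)" if "d \<in> F" for d
      using that is_fun_calc_eigenvector[OF T A(2) w] is_fun_calc_eigenvector[OF T B(2) w] by simp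
    moreover have "bounded_op V A" "bounded_op V B" using A B by (auto simp: is_fun_calc_def)
    ultimately show "A u = B u" unfolding uw using w F by (simp add: bounded_op_sum)
  qed
  have "fun_calc V T f = ?A"
    unfolding fun_calc_def using ex uniq by (intro the_equality) blast+
  then show ?thesis using ex by simp
qed

end

subsection \<open>The sampled operator and the kernel matrix\<close>

interpretation euclid: ip_space euclid
  by standard (auto simp: euclid_def inner_product_space_def inner_add_left intro: inner_commute)

lemma bounded_op_euclid: "bounded_op euclid ((*v) M)" for M :: "real^'n^'n"
proof -
  obtain C where "\<And>x. norm (M *v x) \<le> norm x * C"
    using bounded_linear.bounded[OF matrix_vector_mul_bounded_linear[of M]] by blast
  then show ?thesis
    by (intro euclid.bounded_opI[where C = C])
      (auto simp: euclid_def nrm_def norm_eq_sqrt_inner matrix_vector_right_distrib mult.commute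
        matrix_vector_mult_scaleR)
qed

text \<open>Each \<open>P c *v u\<close> is 0 or an eigenvector for \<open>c\<close>, and together
  they sum to \<open>u\<close>; the functional calculus multiplies each by
  \<open>f c\<close>.\<close>

lemma matrix_fun_spectral:
  fixes M :: "real^'n^'n"
  assumes F: "finite F" and MP: "\<And>c. c \<in> F \<Longrightarrow> M ** P c = c *\<^sub>R P c"
    and P1: "(\<Sum>c\<in>F. P c) = mat 1"
  shows "matrix_fun f M = (\<Sum>c\<in>F. f c *\<^sub>R P c)"
proof -
  have sum_mv: "(\<Sum>c\<in>F. a c *\<^sub>R P c) *v u = (\<Sum>c\<in>F. a c *\<^sub>R (P c *v u))" for a u
    by (simp add: vec_eq_iff matrix_vector_mult_def sum_distrib_left sum_distrib_right mult.assoc)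
      (auto intro: sum.swap)
  have dec: "u = (\<Sum>c\<in>F. P c *v u)" for u using sum_mv[of "\<lambda>_. 1" u] P1 by simp
  have eig: "M *v (P c *v u) = c *\<^sub>R (P c *v u)" if "c \<in> F" for c u
    using MP[OF that] by (simp add: matrix_vector_mul_assoc scaleR_matrix_vector_assoc)
  have d: "euclid.diagonalizable ((*v) M) F"
    unfolding euclid.diagonalizable_def
  proof (intro conjI ballI)
    show "\<exists>w. (\<forall>c\<in>F. w c \<in> car euclid \<and> M *v w c = c *\<^sub>R w c) \<and> u = sum w F" for u
      using dec eig by (intro exI[of _ "\<lambda>c. P c *v u"]) (simp add: euclid_def)
  qed (use F bounded_op_euclid in auto)
  let ?A = "fun_calc euclid ((*v) M) f"
  have A: "is_fun_calc euclid ((*v) M) f ?A" by (rule euclid.fun_calc_diagonalizable[OF d])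
  then have bA: "bounded_op euclid ?A" by (simp add: is_fun_calc_def)
  have "?A u = (\<Sum>c\<in>F. f c *\<^sub>R P c) *v u" for u
  proof -
    have "?A u = ?A (\<Sum>c\<in>F. P c *v u)" using dec[of u] by (rule arg_cong)
    also have "\<dots> = (\<Sum>c\<in>F. ?A (P c *v u))"
      by (rule euclid.bounded_op_sum[OF bA F]) (simp add: euclid_def)
    also have "\<dots> = (\<Sum>c\<in>F. f c *\<^sub>R (P c *v u))"
      using euclid.is_fun_calc_eigenvector[OF bounded_op_euclid A _ eig]
      by (intro sum.cong) (auto simp: euclid_def)
    finally show ?thesis by (simp add: sum_mv)
  qed
  then have "?A = (*v) (\<Sum>c\<in>F. f c *\<^sub>R P c)" by blast
  then show ?thesis by (simp add: matrix_fun_def)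
qed

lemma weighted_kernel_matrix_nth:
  "weighted_kernel_matrix k \<beta> xs $ i $ j =
     sqrt (\<beta> (xs $ i)) * k (xs $ i) (xs $ j) * sqrt (\<beta> (xs $ j)) / real CARD('n)"
  for xs :: "'x^'n"
  by (simp add: weighted_kernel_matrix_def weight_sqrt_matrix_def kernel_matrix_def diag_mat_def
      matrix_matrix_mult_def if_distrib if_distribR sum.delta sum.delta' cong: if_cong)

text \<open>The value \<open>k x y\<close> is the inner product of \<open>k x\<close> and
  \<open>k y\<close>. Symmetry of the kernel makes the weighted kernel matrix symmetric, so that the
  spectral theorem applies to it.\<close>

lemma scalar_rkhs_sym:
  assumes "scalar_rkhs H k"
  shows "k x y = k y x"
proof -
  have H: "hilbert_space H" and k: "\<forall>x. k x \<in> car H"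
    and rep: "\<forall>f\<in>car H. \<forall>x. f x = ip H f (k x)"
    using assms by (simp_all add: scalar_rkhs_def)
  interpret ip_space H using H by unfold_locales (simp add: hilbert_space_def)
  have "k x y = ip H (k x) (k y)" for x y using rep k by blast
  then show ?thesis using ip_sym k by simp
qed

text \<open>The tensor product of the matrix with the identity of \<open>'y\<close>, as an operator
  on \<open>'y^'n\<close>.\<close>

definition mat_act :: "real^'n^'n \<Rightarrow> 'y::real_vector^'n \<Rightarrow> 'y^'n" where
  "mat_act A z = (\<chi> i. \<Sum>j\<in>UNIV. A $ i $ j *\<^sub>R z $ j)"

lemma mat_act_mult: "mat_act A (mat_act B z) = mat_act (A ** B) z"
  by (simp add: mat_act_def vec_eq_iff matrix_matrix_mult_def scaleR_sum_right scaleR_sum_left)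
    (auto intro: sum.swap)

lemma mat_act_scaleR: "mat_act (c *\<^sub>R A) z = c *\<^sub>R mat_act A z"
  by (simp add: mat_act_def vec_eq_iff scaleR_sum_right)

lemma mat_act_sum: "mat_act (\<Sum>c\<in>F. P c) z = (\<Sum>c\<in>F. mat_act (P c) z)"
  by (simp add: mat_act_def vec_eq_iff scaleR_sum_left) (auto intro: sum.swap)

lemma mat_act_one: "mat_act (mat 1) z = z"
  by (simp add: mat_act_def vec_eq_iff mat_def if_distrib[of "\<lambda>a. a *\<^sub>R _"] cong: if_cong)

section \<open>The intertwining of the kernel matrix with the sampled operator\<close>

locale sampled_rkhs =
  fixes k :: "'x \<Rightarrow> 'x \<Rightarrow> real"
    and G :: "('x \<Rightarrow> 'y::real_inner) hspace"
    and xs :: "'x^'n"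
    and \<beta> :: "'x \<Rightarrow> real"
  assumes rkhs: "vector_rkhs G (scalar_type_kernel k)"
    and beta: "\<And>i. 0 \<le> \<beta> (xs $ i)"
    and k_sym: "\<And>x y. k x y = k y x"

sublocale sampled_rkhs \<subseteq> ip_space G
  using rkhs by unfold_locales (simp add: vector_rkhs_def hilbert_space_def)

context sampled_rkhs
begin

abbreviation K :: "'x \<Rightarrow> 'y \<Rightarrow> 'x \<Rightarrow> 'y" where "K \<equiv> K_at (scalar_type_kernel k)"

abbreviation L :: "('x \<Rightarrow> 'y) \<Rightarrow> 'x \<Rightarrow> 'y" where "L \<equiv> sampled_op G \<beta> xs"

abbreviation M :: "real^'n^'n" where "M \<equiv> weighted_kernel_matrix k \<beta> xs"

abbreviation W :: "'y^'n \<Rightarrow> 'y^'n" where "W \<equiv> weight_op (\<lambda>x. sqrt (\<beta> x)) xs"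

text \<open>Up to the factor \<open>n\<close>, \<open>\<phi>\<close> is \<open>S\<^sup>* B\<^sup>1\<^sup>/\<^sup>2\<close>; it intertwines \<open>M\<close> with \<open>S\<^sup>* B S\<close>.\<close>

definition \<phi> :: "'y^'n \<Rightarrow> 'x \<Rightarrow> 'y" where "\<phi> z = (\<Sum>i\<in>UNIV. K (xs $ i) (W z $ i))"

lemma K_car: "K x y \<in> car G"
  and rep: "f \<in> car G \<Longrightarrow> f x \<bullet> y = ip G f (K x y)"
  using rkhs by (auto simp: vector_rkhs_def)

lemma K_eq: "K x y = (\<lambda>t. k t x *\<^sub>R y)"
  by (simp add: K_at_def scalar_type_kernel_def fun_eq_iff scaleR_blinfun.rep_eq)

lemma fun_scaleR: "(c *\<^sub>R f) x = c *\<^sub>R f x" for f :: "'x \<Rightarrow> 'y"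
  by (simp add: scaleR_fun_def)

lemma fun_sum: "(\<Sum>i\<in>I. w i) x = (\<Sum>i\<in>I. w i x)" for w :: "'i \<Rightarrow> 'x \<Rightarrow> 'y"
  by (induction I rule: infinite_finite_induct) auto

lemma phi_car: "\<phi> z \<in> car G"
  unfolding \<phi>_def by (intro mem_sum K_car)

lemma phi_eq: "\<phi> z x = (\<Sum>i\<in>UNIV. (sqrt (\<beta> (xs $ i)) * k x (xs $ i)) *\<^sub>R z $ i)"
  by (simp add: \<phi>_def fun_sum K_eq weight_op_def mult.commute)

lemma phi_sum: "\<phi> (\<Sum>c\<in>F. z c) = (\<Sum>c\<in>F. \<phi> (z c))"
  by (rule ext) (simp add: phi_eq fun_sum scaleR_sum_right, rule sum.swap)

lemma phi_scaleR: "\<phi> (c *\<^sub>R z) = c *\<^sub>R \<phi> z"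
  by (rule ext) (simp add: phi_eq fun_scaleR scaleR_sum_right mult.commute)

text \<open>Nonnegativity lets each weight split into two square roots: one goes into
  \<open>W y\<close>, the other is contained in \<open>\<phi>\<close>.\<close>

lemma sampling_adj_weight: "sampling_adj G xs (weight_op \<beta> xs y) = (1 / real CARD('n)) *\<^sub>R \<phi> (W y)"
  using beta by (simp add: sampling_adj_eq[OF rkhs] \<phi>_def weight_op_def)

lemma L_eq: "L f = (1 / real CARD('n)) *\<^sub>R \<phi> (W (sampling xs f))"
  by (simp add: sampled_op_def sampling_adj_weight)

lemma M_act: "mat_act M z = (1 / real CARD('n)) *\<^sub>R W (sampling xs (\<phi> z))"
  by (simp add: mat_act_def vec_eq_iff weight_op_def sampling_def phi_eq
      weighted_kernel_matrix_nth scaleR_sum_right algebra_simps)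

text \<open>A regrouping: \<open>L\<close> ends with \<open>\<phi>\<close>, and what precedes it,
  applied after \<open>\<phi>\<close>, is the matrix.\<close>

lemma L_phi: "L (\<phi> z) = \<phi> (mat_act M z)"
  by (simp add: L_eq M_act phi_scaleR)

section \<open>Boundedness and diagonalization of the sampled operator\<close>

lemma bounded_op_point: "bounded_op G (\<lambda>f. K x (f x))"
\<comment> \<open>The reproducing property gives \<open>K x y\<close> the squared norm
  \<open>k x x * (norm y)\<^sup>2\<close>. This yields the sign of \<open>k x x\<close> only once
  some \<open>y\<close> is nonzero, hence the absolute value and the case split on
  \<open>f x\<close>.\<close>
proof (rule bounded_opI[where C = "\<bar>k x x\<bar>"])
  have kK: "ip G (K x y) (K x y) = k x x * (norm y)\<^sup>2" for y
    using rep[OF K_car, of x y x y] by (simp add: K_eq dot_square_norm)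
  fix f assume f: "f \<in> car G"
  have n: "0 \<le> nrm G (K x (f x))" "0 \<le> nrm G f" using f by (auto intro: nrm_nonneg K_car)
  show "nrm G (K x (f x)) \<le> \<bar>k x x\<bar> * nrm G f"
  proof (cases "f x = 0")
    case True
    then show ?thesis using n by (simp add: nrm_def kK)
  next
    case False
    have "(norm (f x))\<^sup>2 = ip G f (K x (f x))" using rep[OF f, of x "f x"] by (simp add: dot_square_norm)
    also have "\<dots> \<le> nrm G f * nrm G (K x (f x))" using f K_car by (rule Cauchy_Schwarz)
    finally have "(norm (f x))\<^sup>2 \<le> nrm G f * nrm G (K x (f x))" .
    moreover have kk: "0 \<le> k x x" 
      using ip_nonneg[OF K_car, of x "f x"] False by (simp add: kK zero_le_mult_iff)
    ultimately have "k x x * (norm (f x))\<^sup>2 \<le> k x x * (nrm G f * nrm G (K x (f x)))"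
      by (simp add: mult_left_mono)
    \<comment> \<open>One factor \<open>nrm G (K x (f x))\<close> cancels; if it is 0 the claim is
      trivial.\<close>
    then have "nrm G (K x (f x)) * nrm G (K x (f x)) \<le> (k x x * nrm G f) * nrm G (K x (f x))"
      using nrm_power2[OF K_car, of x "f x"] by (simp add: kK power2_eq_square algebra_simps)
    then show ?thesis using n kk
      by (metis abs_of_nonneg mult_le_cancel_right mult_nonneg_nonneg order_le_less)
  qed
qed (rule K_car, simp_all add: K_eq fun_eq_iff fun_scaleR algebra_simps)

lemma bounded_op_L: "bounded_op G L"
proof -
  have "L = (\<lambda>f. (1 / real CARD('n)) *\<^sub>R (\<Sum>i\<in>UNIV. \<beta> (xs $ i) *\<^sub>R K (xs $ i) (f (xs $ i))))"
    by (rule ext, simp add: sampled_op_def sampling_adj_eq[OF rkhs] weight_op_def sampling_def)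
      (simp add: K_eq scaleR_fun_def mult.commute)
  then show ?thesis
    by (simp only:) (intro bounded_op_scale bounded_op_Sum bounded_op_point finite)
qed

text \<open>By the reproducing property, the squared norm of \<open>\<phi> z\<close> is
  \<open>CARD('n)\<close> times the sum of the inner products of the components of
  \<open>mat_act M z\<close> and \<open>z\<close>. This handles the eigenvalue 0, where no division
  is possible.\<close>

lemma phi_eq_0:
  assumes "mat_act M z = 0"
  shows "\<phi> z = 0"
proof -
  have "ip G (\<phi> z) (\<phi> z) = (\<Sum>i\<in>UNIV. ip G (\<phi> z) (K (xs $ i) (W z $ i)))"
  proof -
    have "ip G f (\<Sum>i\<in>I. w i) = (\<Sum>i\<in>I. ip G f (w i))"
      if f: "f \<in> car G" and "finite I" and "\<And>i. i \<in> I \<Longrightarrow> w i \<in> car G" for f I and w :: "'n \<Rightarrow> _"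
      using that(2,3)
      by (induction I) (use f ip_sym[OF f mem(1)] in \<open>auto simp: ip_add_right mem_sum simp del: plus_fun_apply\<close>)
    from this[OF phi_car, of UNIV] show ?thesis by (simp add: \<phi>_def K_car)
  qed
  also have "\<dots> = (\<Sum>i\<in>UNIV. W (sampling xs (\<phi> z)) $ i \<bullet> z $ i)"
    by (simp add: rep[OF phi_car, symmetric] weight_op_def sampling_def)
  also have "\<dots> = 0" using assms by (simp add: M_act)
  finally show ?thesis using ip_pos[OF phi_car, of z] by force
qed

text \<open>The spectral parts of \<open>W (sampling xs u)\<close> are carried by
  \<open>\<phi>\<close> to eigenvectors of \<open>L\<close>. Rescaled for nonzero \<open>c\<close>,
  they account for all of \<open>L u\<close>, so what is left of \<open>u\<close> lies in the kernel
  of \<open>L\<close>; this is why 0 is adjoined.\<close>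

lemma diagonalizable_L:
  assumes F: "finite F" and MP: "\<And>c. c \<in> F \<Longrightarrow> M ** P c = c *\<^sub>R P c"
    and P1: "(\<Sum>c\<in>F. P c) = mat 1"
  shows "diagonalizable L (insert 0 F)"
  unfolding diagonalizable_def
proof (intro conjI ballI)
  fix u assume u: "u \<in> car G"
  define z where "z c = mat_act (P c) (W (sampling xs u))" for c
  have Mz: "mat_act M (z c) = c *\<^sub>R z c" if "c \<in> F" for c
    by (simp add: z_def mat_act_mult MP[OF that] mat_act_scaleR)
  have sz: "(\<Sum>c\<in>F. z c) = W (sampling xs u)"
    by (simp add: z_def mat_act_sum[symmetric] P1 mat_act_one)
  have z0: "\<phi> (z 0) = 0" if "0 \<in> F" using phi_eq_0 Mz[OF that] by simp
  \<comment> \<open>The factor makes \<open>L (v c)\<close> the \<open>c\<close>-part of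
    \<open>L u\<close> for nonzero \<open>c\<close>. Since division by 0 gives 0, \<open>v 0\<close>
    is 0 and the eigenvalue equation below also holds there.\<close>
  define v where "v c = (1 / (real CARD('n) * c)) *\<^sub>R \<phi> (z c)" for c
  have v: "v c \<in> car G" for c by (auto simp: v_def phi_car)
  have Lv: "L (v c) = c *\<^sub>R v c" if "c \<in> F" for c
    by (simp add: v_def bounded_op_scaleR[OF bounded_op_L phi_car] L_phi Mz[OF that] phi_scaleR)
  define r where "r = u - (\<Sum>c\<in>F - {0}. v c)"
  have r: "r \<in> car G" unfolding r_def using u v by (intro mem mem_sum)
  have "L r = L u - L (\<Sum>c\<in>F - {0}. v c)"
  proof -
    have "L u = L (r + (\<Sum>c\<in>F - {0}. v c))" by (simp only: r_def diff_add_cancel)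
    also have "\<dots> = L r + L (\<Sum>c\<in>F - {0}. v c)"
      using r v by (intro bounded_op_plus[OF bounded_op_L] mem_sum)
    finally show ?thesis by (simp only: add_diff_cancel_right')
  qed
  also have "L (\<Sum>c\<in>F - {0}. v c) = (\<Sum>c\<in>F - {0}. (1 / real CARD('n)) *\<^sub>R \<phi> (z c))"
    using F v by (simp add: bounded_op_sum[OF bounded_op_L] Lv) (simp add: v_def)
  \<comment> \<open>The term at 0 may be restored because \<open>\<phi> (z 0)\<close>
    vanishes.\<close>
  also have "\<dots> = (\<Sum>c\<in>F. (1 / real CARD('n)) *\<^sub>R \<phi> (z c))"
    using F z0 by (intro sum.mono_neutral_left) auto
  also have "\<dots> = L u" by (simp add: L_eq sz[symmetric] phi_sum scaleR_sum_right)
  finally have Lr: "L r = 0" by (simp only: diff_self)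
  let ?w = "\<lambda>c. if c = 0 then r else v c"
  have "(\<Sum>c\<in>insert 0 F. ?w c) = r + (\<Sum>c\<in>F - {0}. ?w c)"
    using F by (simp add: sum.insert_remove)
  also have "(\<Sum>c\<in>F - {0}. ?w c) = (\<Sum>c\<in>F - {0}. v c)" by (intro sum.cong) auto
  finally have "u = (\<Sum>c\<in>insert 0 F. ?w c)" by (simp only: r_def diff_add_cancel)
  then show "\<exists>w. (\<forall>c\<in>insert 0 F. w c \<in> car G \<and> L (w c) = c *\<^sub>R w c) \<and> u = (\<Sum>c\<in>insert 0 F. w c)"
    using r v Lv Lr by (intro exI[of _ ?w]) auto
qed (use F bounded_op_L in auto)

text \<open>The functional calculus of \<open>L\<close> is moved through \<open>\<phi>\<close> onto
  the matrix, one spectral part of \<open>W y\<close> at a time; evaluating at \<open>x\<close> then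
  turns \<open>\<phi>\<close> into the weighted kernel vector.\<close>

lemma regularized_approximation_eq:
  "regularized_approximation G \<beta> xs y f \<in> car G \<and>
    regularized_approximation G \<beta> xs y f x =
       (\<Sum>i\<in>UNIV. (sqrt (\<beta> (xs $ i)) * coefficient_vector k \<beta> xs f x $ i) *\<^sub>R y $ i)"
proof -
  have "transpose M = M"
    by (simp add: vec_eq_iff transpose_def weighted_kernel_matrix_nth k_sym mult.commute mult.left_commute)
  then obtain F P where F: "finite F" and Psym: "\<And>c i j. P c $ i $ j = P c $ j $ i"
    and MP: "\<And>c. M ** P c = c *\<^sub>R P c" and P1: "(\<Sum>c\<in>F. P c) = mat 1"
    using symmetric_matrix_spectral by blast
  define A where "A = fun_calc G L f"
  have A: "is_fun_calc G L f A"
    unfolding A_def by (rule fun_calc_diagonalizable[OF diagonalizable_L[OF F MP P1]])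
  then have bA: "bounded_op G A" by (simp add: is_fun_calc_def)
  define z where "z c = mat_act (P c) (W y)" for c
  \<comment> \<open>By the intertwining relation, \<open>\<phi> (z c)\<close> satisfies the
    eigenvalue equation of \<open>L\<close> at \<open>c\<close>.\<close>
  have Az: "A (\<phi> (z c)) = f c *\<^sub>R \<phi> (z c)" for c
    by (rule is_fun_calc_eigenvector[OF bounded_op_L A phi_car])
      (simp add: L_phi z_def mat_act_mult MP mat_act_scaleR phi_scaleR)
  have "W y = (\<Sum>c\<in>F. z c)"
    by (simp add: z_def mat_act_sum[symmetric] P1 mat_act_one)
  then have R: "regularized_approximation G \<beta> xs y f = (1 / real CARD('n)) *\<^sub>R (\<Sum>c\<in>F. f c *\<^sub>R \<phi> (z c))"
    using F by (simp add: regularized_approximation_def A_def[symmetric] sampling_adj_weight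
        bounded_op_scaleR[OF bA] phi_car phi_sum mem_sum bounded_op_sum[OF bA] Az)
  \<comment> \<open>This sum is \<open>matrix_fun f M\<close>, by
    \<open>matrix_fun_spectral\<close>.\<close>
  let ?Q = "\<Sum>c\<in>F. f c *\<^sub>R P c"
  have "(\<Sum>c\<in>F. f c *\<^sub>R \<phi> (z c)) = \<phi> (mat_act ?Q (W y))"
    by (simp add: mat_act_sum phi_sum z_def mat_act_scaleR phi_scaleR)
  then have "regularized_approximation G \<beta> xs y f x = (1 / real CARD('n)) *\<^sub>R \<phi> (mat_act ?Q (W y)) x"
    by (simp add: R fun_scaleR)
  also have "\<dots> = (\<Sum>i\<in>UNIV. \<Sum>j\<in>UNIV. 
     ((1 / real CARD('n)) * sqrt (\<beta> (xs $ i)) * k x (xs $ i) * ?Q $ i $ j * sqrt (\<beta> (xs $ j))) *\<^sub>R y $ j)"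
    by (simp add: phi_eq mat_act_def weight_op_def scaleR_sum_right mult.assoc)
  also have "\<dots> = (\<Sum>j\<in>UNIV. \<Sum>i\<in>UNIV.
     ((1 / real CARD('n)) * sqrt (\<beta> (xs $ i)) * k x (xs $ i) * ?Q $ i $ j * sqrt (\<beta> (xs $ j))) *\<^sub>R y $ j)"
    by (rule sum.swap)
  also have "\<dots> = (\<Sum>j\<in>UNIV. (sqrt (\<beta> (xs $ j)) * coefficient_vector k \<beta> xs f x $ j) *\<^sub>R y $ j)"
  proof (rule sum.cong[OF refl])
    fix j :: 'n
    have d: "weight_sqrt_matrix \<beta> xs *v kernel_vector k xs x
        = (\<chi> i. sqrt (\<beta> (xs $ i)) * k x (xs $ i))"
      by (simp add: vec_eq_iff weight_sqrt_matrix_def diag_mat_def kernel_vector_def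
          matrix_vector_mult_def if_distrib[of "\<lambda>a. a * _"] cong: if_cong)
    \<comment> \<open>So far the matrix acts on the outputs \<open>W y\<close>; its symmetry lets it
      act on the kernel vector instead, as in the coefficient vector.\<close>
    have "?Q $ j $ i = ?Q $ i $ j" for i by (simp add: Psym[of _ j i])
    then have "coefficient_vector k \<beta> xs f x $ j
        = (\<Sum>i\<in>UNIV. (1 / real CARD('n)) * sqrt (\<beta> (xs $ i)) * k x (xs $ i) * ?Q $ i $ j)"
      unfolding coefficient_vector_def d matrix_fun_spectral[OF F MP P1]
      by (simp add: matrix_vector_mult_def sum_distrib_left mult_ac del: sum_component)
    then show "(\<Sum>i\<in>UNIV. ((1 / real CARD('n)) * sqrt (\<beta> (xs $ i)) * k x (xs $ i) * ?Q $ i $ j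
        * sqrt (\<beta> (xs $ j))) *\<^sub>R y $ j)
      = (sqrt (\<beta> (xs $ j)) * coefficient_vector k \<beta> xs f x $ j) *\<^sub>R y $ j"
      by (simp only: scaleR_sum_left[symmetric] sum_distrib_right[symmetric]) (simp only: mult.commute)
  qed
  finally show ?thesis using phi_car by (auto simp: R intro!: mem_sum)
qed

end

theorem proposition7:
  fixes k :: "'x::{second_countable_topology,t2_space} \<Rightarrow> 'x \<Rightarrow> real"
    and H :: "('x \<Rightarrow> real) hspace"
    and G :: "('x \<Rightarrow> 'y::{real_inner,banach,second_countable_topology}) hspace"
    and xs :: "'x^'n"
    and ys :: "'y^'n"
    and \<beta> :: "'x \<Rightarrow> real"
    and g :: "real \<Rightarrow> real \<Rightarrow> real"
    and s l :: real
  assumes "locally_compact_space (euclidean :: 'x topology)"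
    and "\<nexists>B :: 'y set. finite B \<and> span B = UNIV"
    and "scalar_rkhs H k"
    and "vector_rkhs G (scalar_type_kernel k)"
    and "\<And>i. 0 \<le> \<beta> (xs $ i)"
    and "regularization_family s g"
    and "0 < l" and "l \<le> s"
    and "spectrum G (sampled_op G \<beta> xs) \<subseteq> {0..s}"
    and "matrix_spectrum (weighted_kernel_matrix k \<beta> xs) \<subseteq> {0..s}"
  shows "regularized_approximation G \<beta> xs ys (g l) \<in> car G \<and>
    (\<forall>x. regularized_approximation G \<beta> xs ys (g l) x =
       (\<Sum>i\<in>UNIV. (sqrt (\<beta> (xs $ i)) * coefficient_vector k \<beta> xs (g l) x $ i) *\<^sub>R ys $ i))"
proof -
  interpret sampled_rkhs k G xs \<beta>
    using assms(4,5) scalar_rkhs_sym[OF assms(3)] by unfold_locales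
  show ?thesis using regularized_approximation_eq by blast
qed

end
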